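(* Consider the polynomial optimization problem $$\min_{x\in\mathbb{R}^n}\ \sum_{i=1}^s f_i(x^{(i)})\quad \text{s.t.}\quad g^{(i)}(x^{(i)})\ge 0,\ h^{(i)}(x^{(i)})=0\quad (i=1,\dots,s)\qquad (P)$$ with correlative sparsity pattern $(\mathcal{I}_1,\dots,\mathcal{I}_s)$ as in the context. Assume that for each $i\in[s]$ there are polynomial matrices $L^{(i)}\in\mathbb{R}[x^{(i)}]^{\hat m_i\times n_i}$ and $D^{(i)}\in\mathbb{R}[x^{(i)}]^{\hat m_i\times\hat m_i}$, $\hat m_i=m_i+\ell_i$, with $[\,L^{(i)}\ \ D^{(i)}\,]\,G^{(i)}=I_{\hat m_i}$, and let $\phi^{(i)},\psi^{(i)}\subset\mathbb{R}[z^{(i)}]$ be the polynomial tuples defined from $L^{(i)}$ in the context. For $d\in\mathbb{N}$ let $$\rho_d=\sup\Big\{\gamma\in\mathbb{R}:\ \sum_{i=1}^sf_i-\gamma\in\sum_{i=1}^s\mathrm{IQ}_{\mathcal{I}_i}(h^{(i)},g^{(i)})_{2d}\Big\},\qquad \vartheta_d=\sup\Big\{\gamma\in\mathbb{R}:\ \sum_{i=1}^sf_i-\gamma\in\sum_{i=1}^s\mathrm{IQ}_{\hat{\mathcal{I}}_i}(\phi^{(i)},\psi^{(i)})_{2d}\Big\}$$ be the optimal values of the $d$th order correlatively sparse SOS relaxations of $(P)$ and of its CS-LME reformulation. Then $\vartheta_d\ge\rho_d$ for every relaxation order $d$ such that $2d$ is at least the degree of every $f_i$ and of every polynomial in $g^{(i)},h^{(i)},\phi^{(i)},\psi^{(i)}$,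 $i\in[s]$.
   Context: Setting. $[n]=\{1,\dots,n\}$; $\mathcal{I}_1,\dots,\mathcal{I}_s\subseteq[n]$ with $\bigcup_i\mathcal{I}_i=[n]$, each with a fixed ordering of its elements; $n_i=|\mathcal{I}_i|$; $x^{(i)}=(x_k)_{k\in\mathcal{I}_i}$. For each $i\in[s]$, $f_i\in\mathbb{R}[x^{(i)}]$, $g^{(i)}$ is a tuple of $m_i\ge 0$ polynomials in $\mathbb{R}[x^{(i)}]$ and $h^{(i)}$ is a tuple of $\ell_i\ge 0$ polynomials in $\mathbb{R}[x^{(i)}]$. Standing assumptions on the pattern: (a) running intersection property (RIP): for every $i\in[s-1]$ there is $t\le i$ with $\mathcal{I}_{i+1}\cap\bigcup_{j=1}^i\mathcal{I}_j\subseteq\mathcal{I}_t$; (b) $\mathcal{I}_i\not\subseteq\mathcal{I}_j$ for distinct $i,j\in[s]$; (c) $\mathcal{I}_{i+1}\cap\bigcup_{j=1}^i\mathcal{I}_j\ne\emptyset$ for all $i\in[s-1]$. Notation. $\nabla_i p\in\mathbb{R}[x]^{n_i}$ is the vector of partial derivatives of $p$ with respect to the entries of $x^{(i)}$. For $k\in\mathcal{I}_i$, $e^{(i)}_k\in\mathbb{R}^{n_i}$ is the standard basis vector whose nonzero entry is at the position of $k$ in the ordered tuple $\mathcal{I}_i$. $v_{1:m}$ is the subvector of the first $m$ entries; $v\circ w$ is the entrywise product. The matrix $G^{(i)}$. With $c^{(i)}=(g^{(i)},h^{(i)})=(c^{(i)}_1,\dots,c^{(i)}_{\hat m_i})$,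 $G^{(i)}(x^{(i)})$ is the $(n_i+\hat m_i)\times\hat m_i$ polynomial matrix whose first $n_i$ rows form $[\nabla_i c^{(i)}_1\ \cdots\ \nabla_i c^{(i)}_{\hat m_i}]$ and whose last $\hat m_i$ rows form $\mathrm{diag}(c^{(i)}_1,\dots,c^{(i)}_{\hat m_i})$. $I_r$ is the $r\times r$ identity matrix. Directed clique tree. $A$ is the set of arcs on the node set $[s]$ consisting of the pairs $(i+1,t)$, $i=1,\dots,s-1$, where $t$ is the largest index $t\le i$ with $\mathcal{I}_{i+1}\cap\bigcup_{j=1}^i\mathcal{I}_j\subseteq\mathcal{I}_t$. Put $\mathcal{D}_i=\{t:(t,i)\in A\}$, $\mathcal{A}_i=\{t:(i,t)\in A\}$, $\mathcal{C}_{i,t}=\mathcal{I}_i\cap\mathcal{I}_t$ for $(i,t)\in A$. Auxiliary variables are $\nu_{i,t,k}$ for $(i,t)\in A$, $k\in\mathcal{C}_{i,t}$. Put $\mathcal{J}_i=\{(i,t,k):t\in\mathcal{A}_i,k\in\mathcal{C}_{i,t}\}\cup\{(t,i,k):t\in\mathcal{D}_i,k\in\mathcal{C}_{t,i}\}$, $\hat{\mathcal{I}}_i=\mathcal{I}_i\cup\mathcal{J}_i$, $z^{(i)}=(x^{(i)},(\nu_\gamma)_{\gamma\in\mathcal{J}_i})$ and $$\nu^{(i)}=-\sum_{t\in\mathcal{A}_i}\sum_{k\in\mathcal{C}_{i,t}}\nu_{i,t,k}e^{(i)}_k+\sum_{t\in\mathcal{D}_i}\sum_{k\in\mathcal{C}_{t,i}}\nu_{t,i,k}e^{(i)}_k.$$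 CS-LME reformulation data. $F^{(i)}(z^{(i)})=\nabla_i f_i(x^{(i)})+\nu^{(i)}$, $p^{(i)}(z^{(i)})=L^{(i)}(x^{(i)})F^{(i)}(z^{(i)})$, and $$\phi^{(i)}=\begin{bmatrix}F^{(i)}-\sum_{j=1}^{m_i}p^{(i)}_j\nabla_i g^{(i)}_j-\sum_{j=1}^{\ell_i}p^{(i)}_{m_i+j}\nabla_i h^{(i)}_j\\ h^{(i)}\\ p^{(i)}_{1:m_i}\circ g^{(i)}\end{bmatrix},\qquad \psi^{(i)}=\begin{bmatrix}p^{(i)}_{1:m_i}\\ g^{(i)}\end{bmatrix}.$$ The CS-LME reformulation of $(P)$ is to minimize $\sum_i f_i(x^{(i)})$ over $(x,\nu)$ subject to $\psi^{(i)}(z^{(i)})\ge0$, $\phi^{(i)}(z^{(i)})=0$, $i\in[s]$. Truncated sets. For a tuple of variables $z$, $\mathbb{R}[z]_e$ is the set of polynomials of degree at most $e$ and $\Sigma[z]_e$ the set of sums of squares of polynomials that have degree at most $e$ (both $\{0\}$ if $e<0$; $\deg 0:=0$). For tuples $h=(h_1,\dots,h_\ell)$, $g=(g_1,\dots,g_m)$ in $\mathbb{R}[z]$, $$\mathrm{IQ}(h,g)_{2d}=\sum_{j=1}^{\ell}h_j\,\mathbb{R}[z]_{2d-\deg h_j}+\Sigma[z]_{2d}+\sum_{j=1}^m g_j\,\Sigma[z]_{2d-\deg g_j}.$$ $\mathrm{IQ}_{\mathcal{I}_i}$ means this with $z=x^{(i)}$, and $\mathrm{IQ}_{\hat{\mathcal{I}}_i}$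 means this with $z=z^{(i)}$. Sums of these sets are Minkowski sums in the polynomial ring in all variables $(x,\nu)$; a supremum over the empty set is $-\infty$. *)

theory Defs
  imports
    "HOL-Library.Poly_Mapping"
    "HOL-Library.Set_Algebras"
    "HOL-Library.Extended_Real"
    "Jordan_Normal_Form.Matrix"
begin

section \<open>Real multivariate polynomials\<close>

text \<open>
  \<open>XVar k\<close> is the variable \<open>x\<^sub>k\<close> and \<open>NuVar i t k\<close> is the auxiliary variable with index
  \<open>(i, t, k)\<close>. All polynomials live in the ring in all of these variables; the
  subring in the variables from a set \<open>V\<close> is \<open>polys_in V\<close>.
\<close>

datatype pvar = XVar nat | NuVar nat nat nat

type_synonym mpoly = "(pvar \<Rightarrow>\<^sub>0 nat) \<Rightarrow>\<^sub>0 real"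

definition mconst :: "real \<Rightarrow> mpoly" where
  "mconst c = Poly_Mapping.single 0 c"

definition mvar :: "pvar \<Rightarrow> mpoly" where
  "mvar v = Poly_Mapping.single (Poly_Mapping.single v 1) 1"

definition polys_in :: "pvar set \<Rightarrow> mpoly set" where
  "polys_in V = {p. \<forall>m\<in>Poly_Mapping.keys p. Poly_Mapping.keys m \<subseteq> V}"

text \<open>The total degree, with the convention that the zero polynomial has degree 0.\<close>

definition tdeg :: "mpoly \<Rightarrow> nat" where
  "tdeg p = Max (insert 0 ((\<lambda>m. \<Sum>v\<in>Poly_Mapping.keys m. Poly_Mapping.lookup m v) ` Poly_Mapping.keys p))"

definition partial_deriv :: "pvar \<Rightarrow> mpoly \<Rightarrow> mpoly" where
  "partial_deriv v p =
     (\<Sum>m\<in>Poly_Mapping.keys p. Poly_Mapping.single (m - Poly_Mapping.single v 1)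
                                      (of_nat (Poly_Mapping.lookup m v) * Poly_Mapping.lookup p m))"

text \<open>
  The degree bounds \<open>e\<close> are integers because \<open>2d - deg h\<close> may be negative, in which
  case both truncations are \<open>{0}\<close>. The bound in \<open>trunc_sos\<close> is on the degree of the sum
  of squares, not on the degree of the polynomials being squared.
\<close>

definition trunc_polys :: "pvar set \<Rightarrow> int \<Rightarrow> mpoly set" where
  "trunc_polys V e = {p \<in> polys_in V. p = 0 \<or> int (tdeg p) \<le> e}"

definition sos :: "pvar set \<Rightarrow> mpoly set" where
  "sos V = {\<Sum>q\<leftarrow>qs. q^2 | qs. set qs \<subseteq> polys_in V}"

definition trunc_sos :: "pvar set \<Rightarrow> int \<Rightarrow> mpoly set" where
  "trunc_sos V e = sos V \<inter> trunc_polys V e"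

text \<open>
  \<open>trunc_IQ V h g d\<close> is the set \<open>IQ(h, g)\<close> truncated at degree \<open>2d\<close>, in the variables \<open>V\<close>.
  All sums of sets, including the indexed ones, are Minkowski sums.
\<close>

definition trunc_IQ :: "pvar set \<Rightarrow> mpoly vec \<Rightarrow> mpoly vec \<Rightarrow> nat \<Rightarrow> mpoly set" where
  "trunc_IQ V h g d =
     (\<Sum>j<dim_vec h. (h $ j) *o trunc_polys V (2 * int d - int (tdeg (h $ j))))
     + trunc_sos V (2 * int d)
     + (\<Sum>j<dim_vec g. (g $ j) *o trunc_sos V (2 * int d - int (tdeg (g $ j))))"

text \<open>
  Optimal value of the order \<open>d\<close> correlatively sparse SOS relaxation of minimizing
  \<open>f 1 + \<dots> + f s\<close> subject to \<open>h i = 0\<close> and \<open>g i \<ge> 0\<close>, where the \<open>i\<close>-th block has the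
  variables \<open>V i\<close>.
\<close>

definition cs_sos_value ::
  "nat \<Rightarrow> (nat \<Rightarrow> pvar set) \<Rightarrow> (nat \<Rightarrow> mpoly) \<Rightarrow> (nat \<Rightarrow> mpoly vec) \<Rightarrow> (nat \<Rightarrow> mpoly vec) \<Rightarrow> nat \<Rightarrow> ereal"
where
  "cs_sos_value s V f h g d =
     (SUP \<gamma>\<in>{\<gamma>. (\<Sum>i\<in>{1..s}. f i) - mconst \<gamma> \<in> (\<Sum>i\<in>{1..s}. trunc_IQ (V i) (h i) (g i) d)}.
        ereal \<gamma>)"


section \<open>Sparsity pattern and directed clique tree\<close>

text \<open>
  A pattern is \<open>I :: nat \<Rightarrow> nat list\<close>: the blocks are \<open>I 1, \<dots>, I s\<close> and the list \<open>I i\<close> gives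
  the elements of the \<open>i\<close>-th block in their fixed order. Positions in lists, vectors and
  matrices are counted from 0.
\<close>

definition earlier_overlap :: "(nat \<Rightarrow> nat list) \<Rightarrow> nat \<Rightarrow> nat set" where
  "earlier_overlap I i = set (I (Suc i)) \<inter> (\<Union>j\<in>{1..i}. set (I j))"

definition running_intersection :: "nat \<Rightarrow> (nat \<Rightarrow> nat list) \<Rightarrow> bool" where
  "running_intersection s I \<longleftrightarrow>
     (\<forall>i\<in>{1..<s}. \<exists>t\<in>{1..i}. earlier_overlap I i \<subseteq> set (I t))"

text \<open>The maximum is over a nonempty set if \<open>running_intersection s I\<close> holds.\<close>

definition arcs :: "nat \<Rightarrow> (nat \<Rightarrow> nat list) \<Rightarrow> (nat \<times> nat) set" where
  "arcs s I = {(Suc i, Max {t\<in>{1..i}. earlier_overlap I i \<subseteq> set (I t)}) | i. i \<in> {1..<s}}"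

definition in_nbrs :: "nat \<Rightarrow> (nat \<Rightarrow> nat list) \<Rightarrow> nat \<Rightarrow> nat set" where
  "in_nbrs s I i = {t. (t, i) \<in> arcs s I}"

definition out_nbrs :: "nat \<Rightarrow> (nat \<Rightarrow> nat list) \<Rightarrow> nat \<Rightarrow> nat set" where
  "out_nbrs s I i = {t. (i, t) \<in> arcs s I}"

definition separator :: "(nat \<Rightarrow> nat list) \<Rightarrow> nat \<Rightarrow> nat \<Rightarrow> nat set" where
  "separator I i t = set (I i) \<inter> set (I t)"

definition x_vars :: "(nat \<Rightarrow> nat list) \<Rightarrow> nat \<Rightarrow> pvar set" where
  "x_vars I i = XVar ` set (I i)"

definition nu_vars :: "nat \<Rightarrow> (nat \<Rightarrow> nat list) \<Rightarrow> nat \<Rightarrow> pvar set" where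
  "nu_vars s I i =
     {NuVar i t k | t k. t \<in> out_nbrs s I i \<and> k \<in> separator I i t} \<union>
     {NuVar t i k | t k. t \<in> in_nbrs s I i \<and> k \<in> separator I t i}"

definition z_vars :: "nat \<Rightarrow> (nat \<Rightarrow> nat list) \<Rightarrow> nat \<Rightarrow> pvar set" where
  "z_vars s I i = x_vars I i \<union> nu_vars s I i"


section \<open>Data of the CS-LME reformulation\<close>

definition grad :: "nat list \<Rightarrow> mpoly \<Rightarrow> mpoly vec" where
  "grad xs p = vec (length xs) (\<lambda>r. partial_deriv (XVar (xs ! r)) p)"

definition coord_vec :: "nat list \<Rightarrow> nat \<Rightarrow> mpoly vec" where
  "coord_vec xs k = vec (length xs) (\<lambda>r. if xs ! r = k then 1 else 0)"

text \<open>The matrix \<open>G\<close> of the constraint tuple \<open>c\<close> in the variables \<open>xs\<close>.\<close>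

definition G_mat :: "nat list \<Rightarrow> mpoly vec \<Rightarrow> mpoly mat" where
  "G_mat xs c =
     mat (length xs) (dim_vec c) (\<lambda>(r, j). grad xs (c $ j) $ r) @\<^sub>r mat_diag (dim_vec c) (\<lambda>j. c $ j)"

text \<open>The block row \<open>[A B]\<close> of two matrices with the same number of rows.\<close>

definition block_row :: "mpoly mat \<Rightarrow> mpoly mat \<Rightarrow> mpoly mat" where
  "block_row A B = four_block_mat A B (0\<^sub>m 0 (dim_col A)) (0\<^sub>m 0 (dim_col B))"

definition nu_vec :: "nat \<Rightarrow> (nat \<Rightarrow> nat list) \<Rightarrow> nat \<Rightarrow> mpoly vec" where
  "nu_vec s I i = vec (length (I i)) (\<lambda>r.
     - (\<Sum>t\<in>out_nbrs s I i. \<Sum>k\<in>separator I i t. mvar (NuVar i t k) * coord_vec (I i) k $ r)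
     + (\<Sum>t\<in>in_nbrs s I i. \<Sum>k\<in>separator I t i. mvar (NuVar t i k) * coord_vec (I i) k $ r))"

definition F_vec :: "nat \<Rightarrow> (nat \<Rightarrow> nat list) \<Rightarrow> (nat \<Rightarrow> mpoly) \<Rightarrow> nat \<Rightarrow> mpoly vec" where
  "F_vec s I f i = grad (I i) (f i) + nu_vec s I i"

definition p_vec ::
  "nat \<Rightarrow> (nat \<Rightarrow> nat list) \<Rightarrow> (nat \<Rightarrow> mpoly) \<Rightarrow> (nat \<Rightarrow> mpoly mat) \<Rightarrow> nat \<Rightarrow> mpoly vec"
where
  "p_vec s I f L i = L i *\<^sub>v F_vec s I f i"

definition phi ::
  "nat \<Rightarrow> (nat \<Rightarrow> nat list) \<Rightarrow> (nat \<Rightarrow> mpoly) \<Rightarrow> (nat \<Rightarrow> mpoly vec) \<Rightarrow> (nat \<Rightarrow> mpoly vec) \<Rightarrow>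
   (nat \<Rightarrow> mpoly mat) \<Rightarrow> nat \<Rightarrow> mpoly vec"
where
  "phi s I f g h L i =
     (let p = p_vec s I f L i; m = dim_vec (g i); l = dim_vec (h i) in
        vec (length (I i)) (\<lambda>r. F_vec s I f i $ r
           - (\<Sum>j<m. p $ j * grad (I i) (g i $ j) $ r)
           - (\<Sum>j<l. p $ (m + j) * grad (I i) (h i $ j) $ r))
        @\<^sub>v h i
        @\<^sub>v component_mult (vec_first p m) (g i))"

definition psi ::
  "nat \<Rightarrow> (nat \<Rightarrow> nat list) \<Rightarrow> (nat \<Rightarrow> mpoly) \<Rightarrow> (nat \<Rightarrow> mpoly vec) \<Rightarrow>
   (nat \<Rightarrow> mpoly mat) \<Rightarrow> nat \<Rightarrow> mpoly vec"
where
  "psi s I f g L i = vec_first (p_vec s I f L i) (dim_vec (g i)) @\<^sub>v g i"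

end

(* The tuple phi contains h and psi contains g, so block by block every certificate for the
   original problem is one for the reformulation: put zero multipliers on all other constraints. *)
theory Submission
  imports Defs
begin

text \<open>Both suprema range over those \<gamma> for which the same polynomial, the sum of the
  \<open>f i\<close> minus \<gamma>, lies in a Minkowski sum of truncated sets, so it suffices to
  compare these sets block by block. Passing from the variables \<open>x_vars\<close> to
  \<open>z_vars\<close> only admits more multipliers (\<open>trunc_IQ_mono_vars\<close>), and
  extending the constraint tuples only adds summands that contain 0
  (\<open>trunc_IQ_append_subset\<close>). More feasible \<gamma> give a larger supremum
  (\<open>cs_sos_value_mono\<close>).\<close>

lemma sum_set_mono:
  fixes B C :: "'a \<Rightarrow> 'b::comm_monoid_add set"
  assumes "\<And>i. i \<in> A \<Longrightarrow> B i \<subseteq> C i"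
  shows "sum B A \<subseteq> sum C A"
  using assms
  by (induction A rule: infinite_finite_induct) (simp_all add: set_plus_mono2)

lemma zero_in_sum_set:
  fixes B :: "'a \<Rightarrow> 'b::comm_monoid_add set"
  assumes "\<And>i. i \<in> A \<Longrightarrow> 0 \<in> B i"
  shows "0 \<in> sum B A"
  using assms
  \<comment> \<open>Over an infinite or empty index set the sum is the neutral element of set
    addition, the singleton of 0.\<close>
  by (induction A rule: infinite_finite_induct) (auto simp: set_plus_def intro: bexI[of _ 0])

lemma sum_append_vec:
  fixes T :: "'a \<Rightarrow> 'b::comm_monoid_add"
  shows "(\<Sum>j<dim_vec (u @\<^sub>v v). T ((u @\<^sub>v v) $ j)) =
         (\<Sum>j<dim_vec u. T (u $ j)) + (\<Sum>j<dim_vec v. T (v $ j))"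
proof -
  have "(\<Sum>j<m + k. F j) = (\<Sum>j<m. F j) + (\<Sum>j<k. F (m + j))" for F :: "nat \<Rightarrow> 'b" and m k
    by (induction k) (simp_all add: add.assoc)
  then show ?thesis by simp
qed

text \<open>By \<open>sum_append_vec\<close> the long sum splits into the parts for \<open>u\<close>
  and \<open>v\<close>; each part contains 0, so adding it to the other loses nothing.\<close>

lemma sum_subset_sum_append_vec:
  fixes T :: "'a \<Rightarrow> 'b::comm_monoid_add set"
  assumes "\<And>q. 0 \<in> T q"
  shows "(\<Sum>j<dim_vec v. T (v $ j)) \<subseteq> (\<Sum>j<dim_vec (u @\<^sub>v v). T ((u @\<^sub>v v) $ j))"
    and "(\<Sum>j<dim_vec u. T (u $ j)) \<subseteq> (\<Sum>j<dim_vec (u @\<^sub>v v). T ((u @\<^sub>v v) $ j))"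
proof -
  have "0 \<in> (\<Sum>j<dim_vec w. T (w $ j))" for w :: "'a vec"
    by (simp add: zero_in_sum_set assms)
  then show "(\<Sum>j<dim_vec v. T (v $ j)) \<subseteq> (\<Sum>j<dim_vec (u @\<^sub>v v). T ((u @\<^sub>v v) $ j))"
    and "(\<Sum>j<dim_vec u. T (u $ j)) \<subseteq> (\<Sum>j<dim_vec (u @\<^sub>v v). T ((u @\<^sub>v v) $ j))"
    unfolding sum_append_vec by (metis set_zero_plus2 add.commute)+
qed

lemma trunc_polys_mono: "V \<subseteq> W \<Longrightarrow> trunc_polys V e \<subseteq> trunc_polys W e"
  by (auto simp: trunc_polys_def polys_in_def)

text \<open>The same squares work over \<open>W\<close>, and \<open>tdeg\<close> does not depend on
  the ambient variables.\<close>

lemma trunc_sos_mono: "V \<subseteq> W \<Longrightarrow> trunc_sos V e \<subseteq> trunc_sos W e"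
  unfolding trunc_sos_def trunc_polys_def sos_def polys_in_def by fast

lemma zero_in_trunc_polys: "0 \<in> trunc_polys V e"
  by (simp add: trunc_polys_def polys_in_def)

lemma zero_in_trunc_sos: "0 \<in> trunc_sos V e"
  by (auto simp: trunc_sos_def sos_def zero_in_trunc_polys intro!: exI[of _ "[]"])

lemma zero_in_elt_set_times:
  fixes a :: "'a::mult_zero"
  shows "0 \<in> A \<Longrightarrow> 0 \<in> a *o A"
  by (force simp: elt_set_times_def)

lemma trunc_IQ_mono_vars:
  assumes "V \<subseteq> W"
  shows "trunc_IQ V h g d \<subseteq> trunc_IQ W h g d"
  unfolding trunc_IQ_def
  by (intro set_plus_mono2 sum_set_mono set_times_mono trunc_polys_mono trunc_sos_mono assms)

text \<open>The summand of a constraint \<open>q\<close> depends on \<open>q\<close> alone and not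
  on its position, and it contains 0 even if its degree bound is negative. Each new constraint can
  thus get the multiplier 0.\<close>

lemma trunc_IQ_append_subset:
  "trunc_IQ V h g d \<subseteq> trunc_IQ V (a @\<^sub>v h @\<^sub>v b) (c @\<^sub>v g) d"
proof -
  let ?P = "\<lambda>q. q *o trunc_polys V (2 * int d - int (tdeg q))"
  let ?S = "\<lambda>q. q *o trunc_sos V (2 * int d - int (tdeg q))"
  have P: "0 \<in> ?P q" and S: "0 \<in> ?S q" for q
    by (simp_all add: zero_in_elt_set_times zero_in_trunc_polys zero_in_trunc_sos)
  have "(\<Sum>j<dim_vec h. ?P (h $ j)) \<subseteq>
        (\<Sum>j<dim_vec (a @\<^sub>v h @\<^sub>v b). ?P ((a @\<^sub>v h @\<^sub>v b) $ j))"
    \<comment> \<open>\<open>h\<close> sits in the middle of the longer tuple: append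
      \<open>b\<close> on the right, then \<open>a\<close> on the left.\<close>
    using sum_subset_sum_append_vec(2)[of ?P h b, OF P]
      sum_subset_sum_append_vec(1)[of ?P "h @\<^sub>v b" a, OF P]
    by (rule subset_trans)
  moreover have "(\<Sum>j<dim_vec g. ?S (g $ j)) \<subseteq> (\<Sum>j<dim_vec (c @\<^sub>v g). ?S ((c @\<^sub>v g) $ j))"
    using S by (rule sum_subset_sum_append_vec(1))
  ultimately show ?thesis
    unfolding trunc_IQ_def by (intro set_plus_mono2 subset_refl)
qed

lemma cs_sos_value_mono:
  assumes "\<And>i. i \<in> {1..s} \<Longrightarrow> trunc_IQ (V i) (h i) (g i) d \<subseteq> trunc_IQ (V' i) (h' i) (g' i) d"
  shows "cs_sos_value s V f h g d \<le> cs_sos_value s V' f h' g' d"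
proof -
  have "(\<Sum>i\<in>{1..s}. trunc_IQ (V i) (h i) (g i) d) \<subseteq> (\<Sum>i\<in>{1..s}. trunc_IQ (V' i) (h' i) (g' i) d)"
    using assms by (rule sum_set_mono)
  then show ?thesis
    unfolding cs_sos_value_def by (intro SUP_subset_mono) auto
qed

theorem mainTheorem5:
  fixes n s d :: nat
    and I :: "nat \<Rightarrow> nat list"
    and f :: "nat \<Rightarrow> mpoly"
    and g h :: "nat \<Rightarrow> mpoly vec"
    and L D :: "nat \<Rightarrow> mpoly mat"
  assumes ordered: "\<And>i. i \<in> {1..s} \<Longrightarrow> distinct (I i)"
    and cover: "(\<Union>i\<in>{1..s}. set (I i)) = {1..n}"
    and rip: "running_intersection s I"
    and maximal: "\<And>i j. i \<in> {1..s} \<Longrightarrow> j \<in> {1..s} \<Longrightarrow> i \<noteq> j \<Longrightarrow> \<not> set (I i) \<subseteq> set (I j)"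
    and linked: "\<And>i. i \<in> {1..<s} \<Longrightarrow> earlier_overlap I i \<noteq> {}"
    and f_in: "\<And>i. i \<in> {1..s} \<Longrightarrow> f i \<in> polys_in (x_vars I i)"
    and g_in: "\<And>i. i \<in> {1..s} \<Longrightarrow> set\<^sub>v (g i) \<subseteq> polys_in (x_vars I i)"
    and h_in: "\<And>i. i \<in> {1..s} \<Longrightarrow> set\<^sub>v (h i) \<subseteq> polys_in (x_vars I i)"
    and L_dim: "\<And>i. i \<in> {1..s} \<Longrightarrow>
          L i \<in> carrier_mat (dim_vec (g i) + dim_vec (h i)) (length (I i))"
    and L_in: "\<And>i. i \<in> {1..s} \<Longrightarrow> elements_mat (L i) \<subseteq> polys_in (x_vars I i)"
    and D_dim: "\<And>i. i \<in> {1..s} \<Longrightarrow>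
          D i \<in> carrier_mat (dim_vec (g i) + dim_vec (h i)) (dim_vec (g i) + dim_vec (h i))"
    and D_in: "\<And>i. i \<in> {1..s} \<Longrightarrow> elements_mat (D i) \<subseteq> polys_in (x_vars I i)"
    and LME: "\<And>i. i \<in> {1..s} \<Longrightarrow>
          block_row (L i) (D i) * G_mat (I i) (g i @\<^sub>v h i) = 1\<^sub>m (dim_vec (g i) + dim_vec (h i))"
    and deg_f: "\<And>i. i \<in> {1..s} \<Longrightarrow> tdeg (f i) \<le> 2 * d"
    and deg_constraints: "\<And>i q. i \<in> {1..s} \<Longrightarrow>
          q \<in> set\<^sub>v (g i) \<union> set\<^sub>v (h i) \<union> set\<^sub>v (phi s I f g h L i) \<union> set\<^sub>v (psi s I f g L i) \<Longrightarrow>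
          tdeg q \<le> 2 * d"
  shows "cs_sos_value s (z_vars s I) f (phi s I f g h L) (psi s I f g L) d
           \<ge> cs_sos_value s (x_vars I) f h g d"
proof (rule cs_sos_value_mono)
  fix i
  have "trunc_IQ (x_vars I i) (h i) (g i) d \<subseteq> trunc_IQ (z_vars s I i) (h i) (g i) d"
    by (rule trunc_IQ_mono_vars) (simp add: z_vars_def)
  also have "\<dots> \<subseteq> trunc_IQ (z_vars s I i) (phi s I f g h L i) (psi s I f g L i) d"
    \<comment> \<open>Here \<open>a\<close> is the stationarity block of \<open>phi\<close>,
      \<open>b\<close> the complementarity products, and \<open>c\<close> the multiplier polynomials
      in \<open>psi\<close>.\<close>
    unfolding phi_def psi_def Let_def by (rule trunc_IQ_append_subset)
  finally show "trunc_IQ (x_vars I i) (h i) (g i) d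
      \<subseteq> trunc_IQ (z_vars s I i) (phi s I f g h L i) (psi s I f g L i) d" .
qed

end
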